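(* Let $\mathcal{X},\mathcal{Y}$ be Hilbert spaces and let $A:\mathcal{X}\to\mathcal{Y}$ be a bounded linear operator. Then the following are equivalent: (1) $A$ has non-closed range or the nullspace $N(A)$ is infinite-dimensional. (2) There exists a non-compact bounded linear operator $B:\mathcal{X}\to\mathcal{X}$ such that $AB$ is compact.
   Context: $N(A)$ denotes the nullspace (kernel) of $A$. *)

theory Defs
  imports "HOL-Analysis.Analysis"
begin

text \<open>
  A real Hilbert space is a type of sort \<open>{real_inner, complete_space}\<close>. For complex Hilbert spaces
  the class below puts a complex scalar multiplication and a sesquilinear form (antilinear in the
  first argument) on top of \<open>real_inner\<close>. Restricting scalars and taking the real part of a complex
  inner product gives a real inner product with the same norm, so every complex inner product
  space is an instance. Definiteness is inherited from \<open>inner\<close>, because \<open>cinner x x\<close> is real by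
  \<open>cinner_commute\<close>. A complex Hilbert space is then a type of sort
  \<open>{complex_inner, complete_space}\<close>.
\<close>

class complex_inner = real_inner +
  fixes scaleC :: "complex \<Rightarrow> 'a \<Rightarrow> 'a"
    and cinner :: "'a \<Rightarrow> 'a \<Rightarrow> complex"
  assumes scaleC_add_right: "scaleC a (x + y) = scaleC a x + scaleC a y"
    and scaleC_add_left: "scaleC (a + b) x = scaleC a x + scaleC b x"
    and scaleC_scaleC: "scaleC a (scaleC b x) = scaleC (a * b) x"
    and scaleC_of_real: "scaleC (of_real r) x = r *\<^sub>R x"
    and cinner_commute: "cinner x y = cnj (cinner y x)"
    and cinner_add_right: "cinner x (y + z) = cinner x y + cinner x z"
    and cinner_scaleC_right: "cinner x (scaleC a y) = a * cinner x y"
    and Re_cinner: "Re (cinner x y) = inner x y"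

lemma vector_space_scaleC: "vector_space (scaleC :: complex \<Rightarrow> 'a::complex_inner \<Rightarrow> 'a)"
proof
  fix x :: 'a
  show "scaleC 1 x = x"
    using scaleC_of_real[of 1 x] by simp
qed (simp_all add: scaleC_add_right scaleC_add_left scaleC_scaleC)

instantiation complex :: complex_inner
begin

definition scaleC_complex :: "complex \<Rightarrow> complex \<Rightarrow> complex" where
  "scaleC_complex a x = a * x"

definition cinner_complex :: "complex \<Rightarrow> complex \<Rightarrow> complex" where
  "cinner_complex x y = cnj x * y"

instance
  by standard
    (simp_all add: scaleC_complex_def cinner_complex_def inner_complex_def algebra_simps scaleR_conv_of_real)

end

definition bounded_clinear :: "('a::complex_inner \<Rightarrow> 'b::complex_inner) \<Rightarrow> bool" where
  "bounded_clinear f \<longleftrightarrow> bounded_linear f \<and> (\<forall>c x. f (scaleC c x) = scaleC c (f x))"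

text \<open>
  The scalar multiplication is a parameter, so that the notion applies over both scalar fields.
  (The library's \<open>dim\<close> is \<open>0\<close> on infinite-dimensional subspaces and cannot be used here.)
\<close>

definition infinite_dimensional ::
    "('k::field \<Rightarrow> 'a::ab_group_add \<Rightarrow> 'a) \<Rightarrow> 'a set \<Rightarrow> bool" where
  "infinite_dimensional smul S \<longleftrightarrow> \<not> (\<exists>F. finite F \<and> module.span smul F = S)"

definition nullspace :: "('a::zero \<Rightarrow> 'b::zero) \<Rightarrow> 'a set" where
  "nullspace A = {x. A x = 0}"

text \<open>Linearity is not part of this predicate; it is stated separately where it is used.\<close>

definition compact_operator ::
    "('a::real_normed_vector \<Rightarrow> 'b::real_normed_vector) \<Rightarrow> bool" where
  "compact_operator T \<longleftrightarrow> (\<forall>S. bounded S \<longrightarrow> compact (closure (T ` S)))"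

end

theory Submission
  imports Defs
begin

text \<open>
  Both implications pass through the failure of a lower bound \<open>norm (A x) \<ge> \<epsilon> * norm x\<close> on
  every subspace of finite codimension. If such a bound holds on the orthogonal complement of a
  finite set, then \<open>A\<close> has closed range and finite-dimensional nullspace. Otherwise one chooses
  inductively an orthonormal sequence \<open>e\<close> with \<open>norm (A (e n)) \<le> 2\<^sup>-\<^sup>n\<close>; the orthogonal projection
  \<open>P\<close> onto its closed span is not compact, whereas \<open>A \<circ> P\<close> is a norm limit of finite-rank operators.

  Conversely, let the range be closed, let the nullspace be finite-dimensional with orthogonal
  projection \<open>P\<close>, and let \<open>A \<circ> B\<close> be compact. By the open mapping theorem
  \<open>norm (B x - P (B x)) \<le> K * norm (A (B x))\<close>, so \<open>B - P \<circ> B\<close> is compact; so is \<open>P \<circ> B\<close>,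
  which has finite rank.

  The complex case uses the same real projection \<open>P\<close>, which need not be complex linear, and takes
  \<open>B = P - iPi\<close>. Since \<open>- iPi\<close> is a positive operator, \<open>inner (e n) (B (e n)) \<ge> 1\<close>, which
  excludes compactness because \<open>e\<close> tends weakly to \<open>0\<close>.
\<close>

subsection \<open>Compact operators\<close>

text \<open>Every bounded set lies in a ball around 0, and a closed subset of a compact set is
  compact. The closure properties below then reduce to exhibiting one compact set per
  radius.\<close>

lemma compact_operatorI_cball:
  fixes T :: "'a::real_normed_vector \<Rightarrow> 'b::real_normed_vector"
  assumes "\<And>r. \<exists>K. compact K \<and> T ` cball 0 r \<subseteq> K"
  shows "compact_operator T"
  unfolding compact_operator_def
proof (intro allI impI)
  fix S :: "'a set"
  assume "bounded S"
  then obtain r where "S \<subseteq> cball 0 r"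
    unfolding bounded_iff by (metis mem_cball_0 subsetI)
  moreover obtain K where K: "compact K" "T ` cball 0 r \<subseteq> K"
    using assms by blast
  ultimately have "closure (T ` S) \<subseteq> K"
    by (meson closure_minimal compact_imp_closed image_mono order_trans)
  then show "compact (closure (T ` S))"
    by (metis K(1) closed_closure compact_Int_closed inf.absorb_iff2)
qed

lemma compact_operatorD_cball:
  assumes "compact_operator T"
  obtains K where "compact K" "T ` cball 0 r \<subseteq> K"
proof
  show "compact (closure (T ` cball 0 r))"
    using assms bounded_cball unfolding compact_operator_def by blast
qed (rule closure_subset)

lemma compact_operator_zero: "compact_operator (\<lambda>x. 0)"
  by (rule compact_operatorI_cball, rule exI[of _ "{0}"]) auto

lemma compact_operator_add:
  assumes "compact_operator S" "compact_operator T"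
  shows "compact_operator (\<lambda>x. S x + T x)"
proof (rule compact_operatorI_cball)
  fix r
  obtain K where "compact K" "S ` cball 0 r \<subseteq> K"
    using compact_operatorD_cball assms(1) .
  moreover obtain L where "compact L" "T ` cball 0 r \<subseteq> L"
    using compact_operatorD_cball assms(2) .
  ultimately show "\<exists>K. compact K \<and> (\<lambda>x. S x + T x) ` cball 0 r \<subseteq> K"
    by (intro exI[of _ "{x + y |x y. x \<in> K \<and> y \<in> L}"] conjI compact_sums) blast+
qed

lemma compact_operator_sum:
  assumes "\<And>i. i \<in> I \<Longrightarrow> compact_operator (T i)"
  shows "compact_operator (\<lambda>x. \<Sum>i\<in>I. T i x)"
  using assms
  by (induction I rule: infinite_finite_induct)
    (auto intro: compact_operator_zero compact_operator_add)

lemma compact_operator_comp_left: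
  assumes "bounded_linear S" "compact_operator T"
  shows "compact_operator (\<lambda>x. S (T x))"
proof (rule compact_operatorI_cball)
  fix r
  obtain K where "compact K" "T ` cball 0 r \<subseteq> K"
    using compact_operatorD_cball assms(2) .
  then show "\<exists>K. compact K \<and> (\<lambda>x. S (T x)) ` cball 0 r \<subseteq> K"
    by (intro exI[of _ "S ` K"])
      (auto intro!: compact_continuous_image linear_continuous_on assms(1))
qed

lemma compact_operator_comp_right:
  fixes S :: "'b::real_normed_vector \<Rightarrow> 'c::real_normed_vector"
    and T :: "'a::real_normed_vector \<Rightarrow> 'b"
  assumes "compact_operator S" "bounded_linear T"
  shows "compact_operator (\<lambda>x. S (T x))"
  unfolding compact_operator_def
proof (intro allI impI)
  fix X :: "'a set"
  assume "bounded X"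
  then have "bounded (T ` X)"
    using assms(2) by (rule bounded_linear_image)
  then have "compact (closure (S ` T ` X))"
    using assms(1) unfolding compact_operator_def by blast
  then show "compact (closure ((\<lambda>x. S (T x)) ` X))"
    by (simp add: image_image)
qed

lemma compact_operator_rank_one:
  fixes e :: "'a::real_inner" and y :: "'b::real_normed_vector"
  shows "compact_operator (\<lambda>x. (e \<bullet> x) *\<^sub>R y)"
proof (rule compact_operatorI_cball)
  fix r
  have "\<bar>e \<bullet> x\<bar> \<le> norm e * r" if "norm x \<le> r" for x
    by (meson Cauchy_Schwarz_ineq2 mult_left_mono norm_ge_zero order_trans that)
  then show "\<exists>K. compact K \<and> (\<lambda>x. (e \<bullet> x) *\<^sub>R y) ` cball 0 r \<subseteq> K"
    by (intro exI[of _ "(\<lambda>t. t *\<^sub>R y) ` cball 0 (norm e * r)"])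
      (auto intro!: compact_continuous_image continuous_intros)
qed

text \<open>A finite net for the image under \<open>T\<close> becomes one for the image under
  \<open>Q\<close>, so \<open>Q\<close> maps bounded sets to totally bounded ones. Only differences
  are compared and \<open>T\<close> may land in another space, so this covers both norm limits of
  compact operators and domination of \<open>Q\<close> by a single compact operator.\<close>

lemma compact_operator_approx:
  fixes Q :: "'a::real_normed_vector \<Rightarrow> 'b::{real_normed_vector, complete_space}"
  assumes "\<And>r \<epsilon>. \<epsilon> > 0 \<Longrightarrow> \<exists>T :: 'a \<Rightarrow> 'c::real_normed_vector. compact_operator T \<and>
    (\<forall>x\<in>cball 0 r. \<forall>y\<in>cball 0 r. norm (Q x - Q y) \<le> norm (T x - T y) + \<epsilon>)"
  shows "compact_operator Q"
  unfolding compact_operator_def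
proof (intro allI impI)
  fix S :: "'a set"
  assume "bounded S"
  then obtain r where S: "S \<subseteq> cball 0 r"
    unfolding bounded_iff by (metis mem_cball_0 subsetI)
  have "\<exists>k. finite k \<and> closure (Q ` S) \<subseteq> (\<Union>x\<in>k. ball x \<epsilon>)" if "\<epsilon> > 0" for \<epsilon>
  proof -
    obtain T :: "'a \<Rightarrow> 'c" where T: "compact_operator T"
      "\<And>x y. x \<in> cball 0 r \<Longrightarrow> y \<in> cball 0 r \<Longrightarrow> norm (Q x - Q y) \<le> norm (T x - T y) + \<epsilon> / 4"
      using assms[of "\<epsilon> / 4" r] \<open>\<epsilon> > 0\<close> by auto
    have cpt: "compact (closure (T ` S))"
      using T(1) \<open>bounded S\<close> unfolding compact_operator_def by blast
    \<comment> \<open>The balls are centred at images of points of \<open>S\<close>, so that a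
      finite subcover selects points at which the estimate between \<open>Q\<close> and
      \<open>T\<close> is available.\<close>
    have cover: "closure (T ` S) \<subseteq> (\<Union>x\<in>S. ball (T x) (\<epsilon> / 4))"
    proof
      fix y
      assume "y \<in> closure (T ` S)"
      then obtain x where "x \<in> S" "dist (T x) y < \<epsilon> / 4"
        using \<open>\<epsilon> > 0\<close> closure_approachableD[of y "T ` S" "\<epsilon> / 4"]
        by (auto simp: dist_commute)
      then show "y \<in> (\<Union>x\<in>S. ball (T x) (\<epsilon> / 4))"
        by auto
    qed
    obtain k where k: "k \<subseteq> S" "finite k"
      "closure (T ` S) \<subseteq> (\<Union>x\<in>k. ball (T x) (\<epsilon> / 4))"
      by (rule compactE_image[OF cpt _ cover]) (rule open_ball)
    \<comment> \<open>The radius is \<open>\<epsilon> / 4\<close> from the net plus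
      \<open>\<epsilon> / 4\<close> from the comparison. Closed balls make the finite union closed,
      so it also contains the closure of the image.\<close>
    have "Q ` S \<subseteq> (\<Union>x\<in>k. cball (Q x) (\<epsilon> / 2))"
    proof
      fix y
      assume "y \<in> Q ` S"
      then obtain x where x: "x \<in> S" "y = Q x"
        by blast
      then have "T x \<in> (\<Union>x\<in>k. ball (T x) (\<epsilon> / 4))"
        by (intro subsetD[OF k(3)] subsetD[OF closure_subset] imageI)
      then obtain z where z: "z \<in> k" "dist (T z) (T x) < \<epsilon> / 4"
        by auto
      have "norm (Q z - Q x) \<le> norm (T z - T x) + \<epsilon> / 4"
        using T(2) S x(1) z(1) k(1) by blast
      then have "dist (Q z) y \<le> \<epsilon> / 2"
        using z(2) x(2) by (simp add: dist_norm)
      then show "y \<in> (\<Union>x\<in>k. cball (Q x) (\<epsilon> / 2))"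
        using z(1) by auto
    qed
    then have "closure (Q ` S) \<subseteq> (\<Union>x\<in>k. cball (Q x) (\<epsilon> / 2))"
      by (rule closure_minimal) (simp add: k(2) closed_UN)
    also have "\<dots> \<subseteq> (\<Union>x\<in>Q ` k. ball x \<epsilon>)"
      using \<open>\<epsilon> > 0\<close> by force
    finally show ?thesis
      using k(2) by blast
  qed
  then show "compact (closure (Q ` S))"
    unfolding compact_eq_totally_bounded by (simp add: complete_eq_closed)
qed

section \<open>Orthonormal sequences and weak convergence to zero\<close>

text \<open>The squared distance from \<open>x\<close> to its projection \<open>?p\<close> is
  nonnegative, and it equals the right-hand side minus the left-hand side.\<close>

lemma bessel_inequality:
  fixes e :: "nat \<Rightarrow> 'a::real_inner"
  assumes "\<And>i j. e i \<bullet> e j = (if i = j then 1 else 0)" "finite I"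
  shows "(\<Sum>k\<in>I. (e k \<bullet> x)\<^sup>2) \<le> (norm x)\<^sup>2"
proof -
  let ?p = "\<Sum>k\<in>I. (e k \<bullet> x) *\<^sub>R e k"
  have "x \<bullet> ?p = (\<Sum>k\<in>I. (e k \<bullet> x)\<^sup>2)"
    by (simp add: inner_sum_right power2_eq_square inner_commute)
  moreover have "?p \<bullet> ?p = (\<Sum>k\<in>I. (e k \<bullet> x)\<^sup>2)"
    using assms(2) by (simp add: inner_sum_right inner_sum_left assms(1) power2_eq_square if_distrib cong: if_cong)
  moreover have "0 \<le> (x - ?p) \<bullet> (x - ?p)"
    by simp
  ultimately show ?thesis
    by (simp add: inner_diff_left inner_diff_right inner_commute power2_norm_eq_inner)
qed

lemma orthonormal_weakly_null:
  fixes e :: "nat \<Rightarrow> 'a::real_inner"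
  assumes "\<And>i j. e i \<bullet> e j = (if i = j then 1 else 0)"
  shows "(\<lambda>n. e n \<bullet> x) \<longlonglongrightarrow> 0"
proof -
  have "summable (\<lambda>n. (e n \<bullet> x)\<^sup>2)"
    by (rule summableI_nonneg_bounded[of _ "(norm x)\<^sup>2"])
      (use bessel_inequality[OF assms] in auto)
  then have "(\<lambda>n. (e n \<bullet> x)\<^sup>2) \<longlonglongrightarrow> 0"
    by (rule summable_LIMSEQ_zero)
  then show ?thesis
    by simp
qed

text \<open>If \<open>T (e n)\<close> converged to \<open>y\<close> along a subsequence, then
  \<open>e n \<bullet> T (e n)\<close> would tend to 0 along it, because
  \<open>e n \<bullet> y\<close> does. Asking only for a lower bound on the quadratic form lets the
  lemma serve both the real projection and its complex-linear modification.\<close>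

lemma not_compact_operator_orthonormal:
  fixes e :: "nat \<Rightarrow> 'a::real_inner"
  assumes on: "\<And>i j. e i \<bullet> e j = (if i = j then 1 else 0)"
    and T: "\<And>n. e n \<bullet> T (e n) \<ge> 1"
  shows "\<not> compact_operator T"
proof
  assume "compact_operator T"
  then obtain K where K: "compact K" "T ` cball 0 1 \<subseteq> K"
    by (rule compact_operatorD_cball)
  have ne: "norm (e n) = 1" for n
    using on[of n n] by (simp add: norm_eq_sqrt_inner)
  then have "\<forall>n. T (e n) \<in> K"
    using K(2) by auto
  then obtain y r where r: "strict_mono r" "((\<lambda>n. T (e n)) \<circ> r) \<longlonglongrightarrow> y"
    using K(1) unfolding compact_def by meson
  have "(\<lambda>n. e (r n) \<bullet> y) \<longlonglongrightarrow> 0"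
    using LIMSEQ_subseq_LIMSEQ[OF orthonormal_weakly_null[OF on] r(1)] by (simp add: o_def)
  moreover have "(\<lambda>n. norm (T (e (r n)) - y)) \<longlonglongrightarrow> 0"
    using r(2) by (simp add: o_def LIM_zero tendsto_norm_zero)
  ultimately have "(\<lambda>n. e (r n) \<bullet> y + norm (T (e (r n)) - y)) \<longlonglongrightarrow> 0"
    using tendsto_add by fastforce
  moreover have "1 \<le> e (r n) \<bullet> y + norm (T (e (r n)) - y)" for n
  proof -
    have "e (r n) \<bullet> (T (e (r n)) - y) \<le> norm (T (e (r n)) - y)"
      using norm_cauchy_schwarz[of "e (r n)" "T (e (r n)) - y"] ne by simp
    then show ?thesis
      using T[of "r n"] by (simp add: inner_diff_right)
  qed
  ultimately show False
    using LIMSEQ_le_const[of _ 0 1] by force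
qed

subsection \<open>Orthogonal projections\<close>

lemma finite_dim_projection:
  fixes F :: "'a::real_inner set"
  assumes "finite F"
  obtains P where "bounded_linear P" "compact_operator P" "\<And>x. P x \<in> span F"
    "\<And>x y. y \<in> span F \<Longrightarrow> y \<bullet> (x - P x) = 0"
proof -
  obtain C where C: "finite C" "span C = span F" "pairwise orthogonal C"
    using basis_orthogonal[OF assms] by blast
  \<comment> \<open>The vectors of \<open>C\<close> are orthogonal but not normalised, hence the
    division by \<open>c \<bullet> c\<close>. A zero vector in \<open>C\<close> contributes
    0.\<close>
  define P where "P x = (\<Sum>c\<in>C. (c \<bullet> x) *\<^sub>R (c /\<^sub>R (c \<bullet> c)))" for x
  have "bounded_linear P"
    unfolding P_def
    by (intro bounded_linear_sum bounded_linear_scaleR_const bounded_linear_inner_right)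
  moreover have "compact_operator P"
    unfolding P_def by (intro compact_operator_sum compact_operator_rank_one)
  moreover have "P x \<in> span F" for x
    unfolding P_def C(2)[symmetric] by (intro span_sum span_scale span_base)
  moreover have "y \<bullet> (x - P x) = 0" if "y \<in> span F" for x y
  proof -
    have "orthogonal (x - P x) c" if "c \<in> C" for c
    proof -
      have "c \<bullet> P x = (\<Sum>d\<in>C. if d = c then c \<bullet> x else 0)"
        unfolding P_def inner_sum_right
      proof (rule sum.cong)
        fix d
        assume "d \<in> C"
        then have "c \<noteq> d \<Longrightarrow> c \<bullet> d = 0"
          using C(3) \<open>c \<in> C\<close> by (auto simp: pairwise_def orthogonal_def)
        then show "c \<bullet> (d \<bullet> x) *\<^sub>R (d /\<^sub>R (d \<bullet> d)) = (if d = c then c \<bullet> x else 0)"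
          by (cases "c = 0") auto
      qed simp
      then show ?thesis
        using C(1) \<open>c \<in> C\<close> by (simp add: orthogonal_def inner_diff_right inner_commute[of _ c])
    qed
    then have "orthogonal (x - P x) y"
      using orthogonal_to_span that C(2) by blast
    then show ?thesis
      by (simp add: orthogonal_def inner_commute)
  qed
  ultimately show ?thesis
    using that by blast
qed

text \<open>By Pythagoras the partial sums are Cauchy as soon as the sums of squared coefficients
  are, and these converge by Bessel. The limit of partial sums is exported because later facts about
  \<open>A (P x)\<close> and \<open>x \<bullet> P x\<close> are obtained by passing to this
  limit.\<close>

lemma orthonormal_projection:
  fixes e :: "nat \<Rightarrow> 'a::{real_inner, complete_space}"
  assumes on: "\<And>i j. e i \<bullet> e j = (if i = j then 1 else 0)"
  obtains P where "bounded_linear P" "\<And>x. (\<lambda>n. \<Sum>k<n. (e k \<bullet> x) *\<^sub>R e k) \<longlonglongrightarrow> P x"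
proof -
  define p where "p n x = (\<Sum>k<n. (e k \<bullet> x) *\<^sub>R e k)" for n x
  define s where "s n x = (\<Sum>k<n. (e k \<bullet> x)\<^sup>2)" for n x
  have norm_p: "(norm (\<Sum>k\<in>I. (e k \<bullet> x) *\<^sub>R e k))\<^sup>2 = (\<Sum>k\<in>I. (e k \<bullet> x)\<^sup>2)"
    if "finite I" for I x
    using that unfolding power2_norm_eq_inner
    by (simp add: inner_sum_right inner_sum_left on power2_eq_square
        if_distrib cong: if_cong)
  have Cauchy_p: "Cauchy (\<lambda>n. p n x)" for x
    unfolding Cauchy_altdef
  proof (intro allI impI)
    fix \<epsilon> :: real
    assume "\<epsilon> > 0"
    have "summable (\<lambda>n. (e n \<bullet> x)\<^sup>2)"
      by (rule summableI_nonneg_bounded[of _ "(norm x)\<^sup>2"])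
        (use bessel_inequality[OF on] in auto)
    then have "Cauchy (\<lambda>n. s n x)"
      unfolding s_def by (simp add: summable_iff_convergent convergent_Cauchy)
    then obtain M where M: "\<And>m n. m \<ge> M \<Longrightarrow> n > m \<Longrightarrow> dist (s m x) (s n x) < \<epsilon>\<^sup>2"
      using \<open>\<epsilon> > 0\<close> unfolding Cauchy_altdef by (meson zero_less_power)
    have "dist (p m x) (p n x) < \<epsilon>" if "m \<ge> M" "n > m" for m n
    proof -
      have "p n x - p m x = (\<Sum>k\<in>{m..<n}. (e k \<bullet> x) *\<^sub>R e k)"
        using \<open>n > m\<close> unfolding p_def lessThan_atLeast0 by (intro sum_diff_nat_ivl) auto
      then have "(norm (p n x - p m x))\<^sup>2 = (\<Sum>k\<in>{m..<n}. (e k \<bullet> x)\<^sup>2)"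
        by (simp add: norm_p)
      also have "\<dots> = s n x - s m x"
        using \<open>n > m\<close> unfolding s_def lessThan_atLeast0
        by (intro sum_diff_nat_ivl[symmetric]) auto
      also have "\<dots> < \<epsilon>\<^sup>2"
        using M[OF that] by (simp add: dist_real_def)
      finally have "norm (p n x - p m x) < \<epsilon>"
        using \<open>\<epsilon> > 0\<close> by (simp add: power_less_imp_less_base)
      then show ?thesis
        by (simp add: dist_norm norm_minus_commute)
    qed
    then show "\<exists>M. \<forall>m\<ge>M. \<forall>n>m. dist (p m x) (p n x) < \<epsilon>"
      by blast
  qed
  then obtain P where P: "\<And>x. (\<lambda>n. p n x) \<longlonglongrightarrow> P x"
    unfolding Cauchy_convergent_iff convergent_def by metis
  have "bounded_linear P"
  proof (rule bounded_linear_intro[where K = 1])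
    fix x y :: 'a and r :: real
    have "(\<lambda>n. p n (x + y)) \<longlonglongrightarrow> P x + P y"
      using tendsto_add[OF P P]
      by (simp add: p_def inner_add_right scaleR_add_left sum.distrib)
    then show "P (x + y) = P x + P y"
      using P LIMSEQ_unique by blast
    have "(\<lambda>n. p n (r *\<^sub>R x)) \<longlonglongrightarrow> r *\<^sub>R P x"
      using tendsto_scaleR[OF tendsto_const P]
      by (simp add: p_def scaleR_sum_right)
    then show "P (r *\<^sub>R x) = r *\<^sub>R P x"
      using P LIMSEQ_unique by blast
    have "norm (p n x) \<le> norm x" for n
      using bessel_inequality[OF on, of "{..<n}" x] norm_p[of "{..<n}" x]
      by (simp add: p_def power2_le_imp_le)
    then show "norm (P x) \<le> norm x * 1"
      using LIMSEQ_le_const2[OF tendsto_norm[OF P]] by auto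
  qed
  then show ?thesis
    using P that unfolding p_def by blast
qed

text \<open>The vectors \<open>A (e k)\<close> decay geometrically, so cutting the series for
  \<open>A (P x)\<close> after \<open>n\<close> terms leaves a tail of at most
  \<open>2 * (1 / 2) ^ n\<close> times \<open>norm x\<close>. The truncations are finite sums of
  rank-one operators.\<close>

lemma compact_operator_comp_projection:
  fixes A :: "'a::real_inner \<Rightarrow> 'b::{real_normed_vector, complete_space}"
  assumes A: "bounded_linear A"
    and e: "\<And>n. norm (e n) = 1" "\<And>n. norm (A (e n)) \<le> (1 / 2) ^ n"
    and P: "\<And>x. (\<lambda>n. \<Sum>k<n. (e k \<bullet> x) *\<^sub>R e k) \<longlonglongrightarrow> P x"
  shows "compact_operator (\<lambda>x. A (P x))"
proof (rule compact_operator_approx)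
  interpret A: bounded_linear A by fact
  define T where "T n x = (\<Sum>k<n. (e k \<bullet> x) *\<^sub>R A (e k))" for n x
  have bound: "norm (A (P x) - T n x) \<le> norm x * (2 * (1 / 2) ^ n)" for n x
  proof (rule LIMSEQ_le_const2)
    have "(\<lambda>m. T m x) \<longlonglongrightarrow> A (P x)"
      using A.tendsto[OF P[of x]] by (simp add: T_def A.sum A.scaleR)
    then show "(\<lambda>m. norm (T m x - T n x)) \<longlonglongrightarrow> norm (A (P x) - T n x)"
      by (intro tendsto_intros)
    have "norm (T m x - T n x) \<le> norm x * (2 * (1 / 2) ^ n)" if "m \<ge> n" for m
    proof -
      have "T m x - T n x = (\<Sum>k\<in>{n..<m}. (e k \<bullet> x) *\<^sub>R A (e k))"
        using that unfolding T_def lessThan_atLeast0 by (intro sum_diff_nat_ivl) auto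
      also have "norm \<dots> \<le> (\<Sum>k\<in>{n..<m}. norm x * (1 / 2) ^ k)"
      proof (rule sum_norm_le)
        fix k
        have "\<bar>e k \<bullet> x\<bar> \<le> norm x"
          using Cauchy_Schwarz_ineq2[of "e k" x] e(1) by simp
        then show "norm ((e k \<bullet> x) *\<^sub>R A (e k)) \<le> norm x * (1 / 2) ^ k"
          using e(2) by (auto intro: mult_mono)
      qed
      also have "\<dots> = norm x * (\<Sum>k\<in>{n..<m}. (1 / 2) ^ k)"
        by (simp add: sum_distrib_left)
      also have "(\<Sum>k\<in>{n..<m}. (1 / 2) ^ k) = 2 * (1 / 2) ^ n - 2 * (1 / 2 :: real) ^ m"
        using that by (induction m rule: dec_induct) simp_all
      also have "norm x * \<dots> \<le> norm x * (2 * (1 / 2) ^ n)"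
        by (intro mult_left_mono) simp_all
      finally show ?thesis .
    qed
    then show "\<exists>N. \<forall>m\<ge>N. norm (T m x - T n x) \<le> norm x * (2 * (1 / 2) ^ n)"
      by blast
  qed
  fix r \<epsilon> :: real
  assume "\<epsilon> > 0"
  \<comment> \<open>Two points of the ball produce a total error of at most
    \<open>4 * \<bar>r\<bar> * (1 / 2) ^ n\<close>. The added 1 keeps the denominator positive when
    \<open>r = 0\<close>.\<close>
  obtain n where n: "(1 / 2) ^ n < \<epsilon> / (4 * \<bar>r\<bar> + 1)"
    using real_arch_pow_inv[of "\<epsilon> / (4 * \<bar>r\<bar> + 1)" "1 / 2"] \<open>\<epsilon> > 0\<close> by auto
  have small: "\<bar>r\<bar> * (2 * (1 / 2) ^ n) + \<bar>r\<bar> * (2 * (1 / 2) ^ n) \<le> \<epsilon>"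
  proof -
    have "\<bar>r\<bar> * (2 * (1 / 2) ^ n) + \<bar>r\<bar> * (2 * (1 / 2) ^ n) \<le> (1 / 2) ^ n * (4 * \<bar>r\<bar> + 1)"
      by (simp add: algebra_simps)
    also have "\<dots> \<le> \<epsilon>"
      using n by (simp add: pos_less_divide_eq)
    finally show ?thesis .
  qed
  show "\<exists>T :: 'a \<Rightarrow> 'b. compact_operator T \<and> (\<forall>x\<in>cball 0 r. \<forall>y\<in>cball 0 r.
      norm (A (P x) - A (P y)) \<le> norm (T x - T y) + \<epsilon>)"
  proof (intro exI conjI ballI)
    show "compact_operator (T n)"
      unfolding T_def by (intro compact_operator_sum compact_operator_rank_one)
    fix x y :: 'a
    assume "x \<in> cball 0 r" "y \<in> cball 0 r"
    then have "norm x * (2 * (1 / 2) ^ n) \<le> \<bar>r\<bar> * (2 * (1 / 2) ^ n)"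
      "norm y * (2 * (1 / 2) ^ n) \<le> \<bar>r\<bar> * (2 * (1 / 2) ^ n)"
      by (auto intro!: mult_right_mono)
    then have "norm (A (P x) - T n x) + norm (A (P y) - T n y) \<le> \<epsilon>"
      using bound[of x n] bound[of y n] small by linarith
    moreover have "norm (A (P x) - A (P y)) \<le>
        norm (T n x - T n y) + (norm (A (P x) - T n x) + norm (A (P y) - T n y))"
      by norm
    ultimately show "norm (A (P x) - A (P y)) \<le> norm (T n x - T n y) + \<epsilon>"
      by linarith
  qed
qed

subsection \<open>Operators with closed range\<close>

text \<open>This is the open mapping theorem in quantitative form. The closed range is completely
  metrizable, so Baire's theorem yields a ball in which images of a bounded set are dense;
  successive approximation then replaces approximate preimages by exact ones.\<close>

lemma closed_range_lift:
  fixes A :: "'a::{real_normed_vector, complete_space} \<Rightarrow> 'b::{real_normed_vector, complete_space}"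
  assumes A: "bounded_linear A" and cl: "closed (range A)"
  obtains K where "K \<ge> 0" "\<And>y. y \<in> range A \<Longrightarrow> \<exists>x. A x = y \<and> norm x \<le> K * norm y"
proof -
  interpret A: bounded_linear A by fact
  have range: "subspace (range A)"
    using linear_subspace_image[OF A.linear subspace_UNIV] by simp
  let ?X = "top_of_set (range A)"
  define C where "C n = range A \<inter> closure (A ` cball 0 (real n))" for n
  have "\<exists>n. ?X interior_of (C n) \<noteq> {}"
  proof (rule ccontr)
    assume "\<nexists>n. ?X interior_of (C n) \<noteq> {}"
    then have "?X interior_of (\<Union>(range C)) = {}"
      by (intro Baire_category_alt disjI1 completely_metrizable_space_closedin
          completely_metrizable_space_euclidean)
        (use cl in \<open>auto simp: C_def closedin_closed_Int\<close>)
    moreover have "\<Union>(range C) = range A"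
    proof -
      have "A x \<in> C (nat \<lceil>norm x\<rceil>)" for x
        unfolding C_def by (auto intro!: closure_subset[THEN subsetD] imageI simp: real_nat_ceiling_ge)
      then show ?thesis
        unfolding C_def by blast
    qed
    ultimately show False
      by (metis empty_not_UNIV image_is_empty interior_of_topspace topspace_euclidean_subtopology)
  qed
  then obtain n U y where U: "openin ?X U" "U \<subseteq> C n" "y \<in> U"
    unfolding interior_of_def by blast
  then obtain r where r: "r > 0" "ball y r \<inter> range A \<subseteq> closure (A ` cball 0 (real n))"
    unfolding openin_contains_ball C_def by fast
  have y: "y \<in> range A"
    using U unfolding C_def by blast
  \<comment> \<open>Approximate preimages of \<open>y + z\<close> and of \<open>y\<close> are
    subtracted. This moves the ball from \<open>y\<close> to the origin at the price of doubling the
    bound \<open>real n\<close>.\<close>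
  have approx: "\<exists>x. norm x \<le> 2 * real n \<and> norm (z - A x) < \<epsilon>"
    if "z \<in> range A" "norm z < r" "\<epsilon> > 0" for z \<epsilon>
  proof -
    have "y + z \<in> range A"
      using range y that(1) by (rule subspace_add)
    then have "y + z \<in> closure (A ` cball 0 (real n))"
      using r(2) that(2) by (intro subsetD[OF r(2)]) (simp add: dist_norm)
    then obtain u where u: "norm u \<le> real n" "norm (A u - (y + z)) < \<epsilon> / 2"
      using closure_approachableD[of "y + z" "A ` cball 0 (real n)" "\<epsilon> / 2"] \<open>\<epsilon> > 0\<close>
      by (auto simp: dist_norm norm_minus_commute)
    have "y \<in> closure (A ` cball 0 (real n))"
      using r y by auto
    then obtain v where v: "norm v \<le> real n" "norm (A v - y) < \<epsilon> / 2"
      using closure_approachableD[of y "A ` cball 0 (real n)" "\<epsilon> / 2"] \<open>\<epsilon> > 0\<close>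
      by (auto simp: dist_norm norm_minus_commute)
    have "norm (z - A (u - v)) \<le> norm (A u - (y + z)) + norm (A v - y)"
      unfolding A.diff by norm
    moreover have "norm (u - v) \<le> norm u + norm v"
      by (rule norm_triangle_ineq4)
    ultimately show ?thesis
      using u v by (intro exI[of _ "u - v"]) linarith
  qed
  \<comment> \<open>Dividing \<open>z\<close> by \<open>t = 2 * norm z / r\<close> gives norm
    \<open>r / 2\<close>, inside the ball. Scaling back turns the bound \<open>2 * real n\<close>
    into \<open>M * norm z\<close> and the error \<open>r / 4\<close> into
    \<open>norm z / 2\<close>.\<close>
  define M where "M = 4 * real n / r"
  have "\<exists>x. norm x \<le> M * norm z \<and> norm (z - A x) \<le> norm z / 2" if "z \<in> range A" for z
  proof (cases "z = 0")
    case True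
    then show ?thesis
      by (intro exI[of _ 0]) (simp add: A.zero)
  next
    case False
    define t where "t = 2 * norm z / r"
    have "t > 0"
      using False r(1) by (simp add: t_def)
    have "z /\<^sub>R t \<in> range A"
      using range that by (rule subspace_scale)
    moreover have "norm (z /\<^sub>R t) < r"
      using False r(1) by (simp add: t_def)
    ultimately obtain x where x: "norm x \<le> 2 * real n" "norm (z /\<^sub>R t - A x) < r / 4"
      using approx[of "z /\<^sub>R t" "r / 4"] r(1) by auto
    have "z - A (t *\<^sub>R x) = t *\<^sub>R (z /\<^sub>R t - A x)"
      using \<open>t > 0\<close> by (simp add: A.scaleR algebra_simps)
    then have "norm (z - A (t *\<^sub>R x)) = t * norm (z /\<^sub>R t - A x)"
      using \<open>t > 0\<close> by simp
    also have "\<dots> \<le> t * (r / 4)"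
      using x(2) \<open>t > 0\<close> by (intro mult_left_mono) auto
    also have "\<dots> = norm z / 2"
      using r(1) by (simp add: t_def)
    finally have "norm (z - A (t *\<^sub>R x)) \<le> norm z / 2" .
    moreover have "t * norm x \<le> t * (2 * real n)"
      using x(1) \<open>t > 0\<close> by (intro mult_left_mono) auto
    then have "norm (t *\<^sub>R x) \<le> M * norm z"
      using \<open>t > 0\<close> r(1) by (simp add: t_def M_def field_simps)
    ultimately show ?thesis
      by blast
  qed
  then obtain g where g: "\<And>z. z \<in> range A \<Longrightarrow> norm (g z) \<le> M * norm z"
    "\<And>z. z \<in> range A \<Longrightarrow> norm (z - A (g z)) \<le> norm z / 2"
    by metis
  have "M \<ge> 0"
    using r(1) by (simp add: M_def)
  show ?thesis
  proof (rule that[of "2 * M"])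
    show "2 * M \<ge> 0"
      using \<open>M \<ge> 0\<close> by simp
    fix y
    assume y: "y \<in> range A"
    \<comment> \<open>\<open>z k\<close> is the residual after \<open>k\<close> corrections, and the
      partial sums \<open>s n\<close> of the corrections satisfy \<open>A (s n) = y - z n\<close>.
      Residuals halve each time, so the geometric series gives the constant
      \<open>2 * M\<close>.\<close>
    define z where "z k = ((\<lambda>z. z - A (g z)) ^^ k) y" for k
    have z_Suc: "z (Suc k) = z k - A (g (z k))" and z_0: "z 0 = y" for k
      by (simp_all add: z_def)
    have z_range: "z k \<in> range A" for k
    proof (induction k)
      case (Suc k)
      then show ?case
        unfolding z_Suc using range by (blast intro: subspace_diff)
    qed (simp add: z_0 y)
    have z_le: "norm (z k) \<le> norm y * (1 / 2) ^ k" for k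
    proof (induction k)
      case (Suc k)
      then show ?case
        using g(2)[OF z_range[of k]] by (simp add: z_Suc)
    qed (simp add: z_0)
    define s where "s n = (\<Sum>k<n. g (z k))" for n
    have g_le: "norm (g (z k)) \<le> M * norm y * (1 / 2) ^ k" for k
      using g(1)[OF z_range[of k]] mult_left_mono[OF z_le[of k] \<open>M \<ge> 0\<close>] by simp
    have s_le: "norm (s n - s m) \<le> 2 * M * norm y * (1 / 2) ^ m" if "m \<le> n" for m n
    proof -
      have "s n - s m = (\<Sum>k\<in>{m..<n}. g (z k))"
        using that unfolding s_def lessThan_atLeast0 by (intro sum_diff_nat_ivl) auto
      also have "norm \<dots> \<le> (\<Sum>k\<in>{m..<n}. M * norm y * (1 / 2) ^ k)"
        by (rule sum_norm_le) (rule g_le)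
      also have "\<dots> = M * norm y * (\<Sum>k\<in>{m..<n}. (1 / 2) ^ k)"
        by (simp add: sum_distrib_left)
      also have "(\<Sum>k\<in>{m..<n}. (1 / 2) ^ k) = 2 * (1 / 2) ^ m - 2 * (1 / 2 :: real) ^ n"
        using that by (induction n rule: dec_induct) simp_all
      also have "M * norm y * \<dots> \<le> M * norm y * (2 * (1 / 2) ^ m)"
        using \<open>M \<ge> 0\<close> by (intro mult_left_mono) simp_all
      finally show ?thesis
        by (simp add: mult_ac)
    qed
    have geometric: "(\<lambda>m. c * (1 / 2 :: real) ^ m) \<longlonglongrightarrow> 0" for c
      by (intro tendsto_mult_right_zero LIMSEQ_power_zero) simp
    have "Cauchy s"
      unfolding Cauchy_altdef
    proof (intro allI impI)
      fix \<epsilon> :: real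
      assume "\<epsilon> > 0"
      then have "\<forall>\<^sub>F m in sequentially. 2 * M * norm y * (1 / 2) ^ m < \<epsilon>"
        using order_tendstoD(2)[OF geometric] by blast
      then obtain N where "\<And>m. m \<ge> N \<Longrightarrow> 2 * M * norm y * (1 / 2) ^ m < \<epsilon>"
        by (auto simp: eventually_sequentially)
      then have "dist (s m) (s n) < \<epsilon>" if "m \<ge> N" "n > m" for m n
        using s_le[of m n] that by (fastforce simp: dist_norm norm_minus_commute)
      then show "\<exists>N. \<forall>m\<ge>N. \<forall>n>m. dist (s m) (s n) < \<epsilon>"
        by blast
    qed
    then obtain x where x: "s \<longlonglongrightarrow> x"
      unfolding Cauchy_convergent_iff convergent_def by blast
    have "norm x \<le> 2 * M * norm y"
      using LIMSEQ_le_const2[OF tendsto_norm[OF x]] s_le[of 0] by (auto simp: s_def)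
    moreover have "A x = y"
    proof -
      have "A (s n) = y - z n" for n
        by (induction n) (simp_all add: s_def A.zero A.add z_Suc z_0)
      moreover have "z \<longlonglongrightarrow> 0"
        by (rule Lim_null_comparison[OF _ geometric[of "norm y"]]) (simp add: z_le)
      ultimately have "(\<lambda>n. A (s n)) \<longlonglongrightarrow> y"
        using tendsto_diff[OF tendsto_const[of y]] by fastforce
      then show ?thesis
        using A.tendsto[OF x] LIMSEQ_unique by blast
    qed
    ultimately show "\<exists>x. A x = y \<and> norm x \<le> 2 * M * norm y"
      by blast
  qed
qed

section \<open>Finite-dimensional extensions of closed subspaces, and lower bounds on finite
  codimension\<close>

text \<open>For \<open>v\<close> outside \<open>M\<close>, the positive distance \<open>d\<close>
  from \<open>v\<close> to \<open>M\<close> controls the coefficient of \<open>v\<close>. Along a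
  convergent sequence the coefficients are therefore Cauchy, and subtracting their multiples of
  \<open>v\<close> leaves a convergent sequence in \<open>M\<close>.\<close>

lemma closed_span_insert:
  fixes M :: "'a::real_normed_vector set"
  assumes "subspace M" "closed M"
  shows "closed (span (insert v M))"
proof (cases "v \<in> M")
  case True
  then show ?thesis
    using assms by (metis insert_absorb span_eq_iff)
next
  case False
  define d where "d = infdist v M"
  have "0 \<in> M"
    using assms(1) by (rule subspace_0)
  then have "d > 0"
    using False assms(2) in_closed_iff_infdist_zero[of M v] infdist_nonneg[of v M]
    unfolding d_def by force
  have d_le: "\<bar>t\<bar> * d \<le> norm (m + t *\<^sub>R v)" if "m \<in> M" for t m
  proof (cases "t = 0")
    case False
    have "(- 1 / t) *\<^sub>R m \<in> M"
      using assms(1) that by (rule subspace_scale)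
    then have "d \<le> norm (v - (- 1 / t) *\<^sub>R m)"
      unfolding d_def dist_norm[symmetric] by (rule infdist_le)
    then have "\<bar>t\<bar> * d \<le> \<bar>t\<bar> * norm (v - (- 1 / t) *\<^sub>R m)"
      by (intro mult_left_mono) auto
    also have "\<dots> = norm (t *\<^sub>R (v - (- 1 / t) *\<^sub>R m))"
      by simp
    also have "t *\<^sub>R (v - (- 1 / t) *\<^sub>R m) = m + t *\<^sub>R v"
      using False by (simp add: algebra_simps)
    finally show ?thesis .
  qed simp
  show ?thesis
    unfolding closed_sequential_limits
  proof (intro allI impI, elim conjE)
    fix y l
    assume y: "\<forall>n. y n \<in> span (insert v M)" and l: "y \<longlonglongrightarrow> l"
    have "span M = M"
      using assms(1) by simp
    then obtain t where t: "\<And>n. y n - t n *\<^sub>R v \<in> M"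
      using y unfolding span_breakdown_eq by metis
    have "\<bar>t m - t n\<bar> * d \<le> norm (y m - y n)" for m n
      using d_le[OF subspace_diff[OF assms(1) t[of m] t[of n]], of "t m - t n"]
      by (simp add: algebra_simps)
    then have t_le: "dist (t m) (t n) \<le> dist (y m) (y n) / d" for m n
      using \<open>d > 0\<close> by (simp add: dist_norm pos_le_divide_eq)
    have "Cauchy t"
      unfolding Cauchy_def
    proof (intro allI impI)
      fix \<epsilon> :: real
      assume "\<epsilon> > 0"
      then have "\<epsilon> * d > 0"
        using \<open>d > 0\<close> by simp
      then obtain N where N: "\<And>m n. m \<ge> N \<Longrightarrow> n \<ge> N \<Longrightarrow> dist (y m) (y n) < \<epsilon> * d"
        using LIMSEQ_imp_Cauchy[OF l] unfolding Cauchy_def by meson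
      then have "dist (t m) (t n) < \<epsilon>" if "m \<ge> N" "n \<ge> N" for m n
      proof -
        have "dist (y m) (y n) / d < \<epsilon>"
          using N[OF that] \<open>d > 0\<close> by (simp add: pos_divide_less_eq)
        then show ?thesis
          using t_le[of m n] by linarith
      qed
      then show "\<exists>N. \<forall>m\<ge>N. \<forall>n\<ge>N. dist (t m) (t n) < \<epsilon>"
        by (intro exI[of _ N]) simp
    qed
    then obtain u where "t \<longlonglongrightarrow> u"
      unfolding Cauchy_convergent_iff convergent_def by blast
    then have "(\<lambda>n. y n - t n *\<^sub>R v) \<longlonglongrightarrow> l - u *\<^sub>R v"
      using l by (intro tendsto_intros)
    then have "l - u *\<^sub>R v \<in> M"
      using closed_sequentially[OF assms(2), of "\<lambda>n. y n - t n *\<^sub>R v"] t by simp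
    then show "l \<in> span (insert v M)"
      unfolding span_breakdown_eq using span_base by blast
  qed
qed

lemma closed_span_finite_Un:
  fixes M :: "'a::real_normed_vector set"
  assumes "finite F" "subspace M" "closed M"
  shows "closed (span (F \<union> M))"
  using assms(1)
proof induction
  case empty
  then show ?case
    using assms by (metis span_eq_iff sup_bot_left)
next
  case (insert v F)
  have "closed (span (insert v (span (F \<union> M))))"
    using insert.IH by (intro closed_span_insert) auto
  also have "span (insert v (span (F \<union> M))) = span (insert v F \<union> M)"
    unfolding span_insert span_span Un_insert_left ..
  finally show ?case .
qed

lemma infinite_dimensional_scaleR:
  "infinite_dimensional scaleR S \<longleftrightarrow> (\<nexists>F. finite F \<and> span F = S)"
  by (simp add: infinite_dimensional_def span_raw_def)

text \<open>The lower bound makes the image of \<open>F\<^sup>\<bottom>\<close> complete, and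
  adjoining the finitely many images of \<open>F\<close> yields the whole range. On the nullspace,
  the projection onto \<open>span F\<close> is injective: a null vector that it kills lies in
  \<open>F\<^sup>\<bottom>\<close>, where the bound forces it to be 0.\<close>

lemma bounded_below_on_finite_codim:
  fixes A :: "'a::{real_inner, complete_space} \<Rightarrow> 'b::{real_normed_vector, complete_space}"
  assumes A: "bounded_linear A" and F: "finite F" and "\<epsilon> > 0"
    and below: "\<And>x. x \<in> F\<^sup>\<bottom> \<Longrightarrow> \<epsilon> * norm x \<le> norm (A x)"
  shows "closed (range A)" "\<not> infinite_dimensional scaleR (nullspace A)"
proof -
  interpret A: bounded_linear A by fact
  obtain P where P: "bounded_linear P" "\<And>x. P x \<in> span F"
    "\<And>x y. y \<in> span F \<Longrightarrow> y \<bullet> (x - P x) = 0"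
    using finite_dim_projection[OF F] by metis
  have rest: "x - P x \<in> F\<^sup>\<bottom>" for x
    using P(3) by (auto simp: orthogonal_comp_def orthogonal_def span_base)
  have "F\<^sup>\<bottom> = (\<Inter>y\<in>F. {x. y \<bullet> x = 0})"
    by (auto simp: orthogonal_comp_def orthogonal_def)
  then have "closed (F\<^sup>\<bottom>)"
    by (simp add: closed_INT closed_hyperplane)
  then have "complete (A ` (F\<^sup>\<bottom>))"
    using complete_isometric_image[OF \<open>\<epsilon> > 0\<close> subspace_orthogonal_comp A] below
    by (simp add: complete_eq_closed)
  moreover have "subspace (A ` (F\<^sup>\<bottom>))"
    using linear_subspace_image[OF A.linear subspace_orthogonal_comp] .
  ultimately have "closed (span (A ` F \<union> A ` (F\<^sup>\<bottom>)))"
    using F by (intro closed_span_finite_Un) (auto simp: complete_eq_closed)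
  also have "span (A ` F \<union> A ` (F\<^sup>\<bottom>)) = A ` span (F \<union> F\<^sup>\<bottom>)"
    unfolding image_Un[symmetric] by (rule linear_span_image[OF A.linear])
  also have "span (F \<union> F\<^sup>\<bottom>) = UNIV"
  proof -
    have "P x + (x - P x) \<in> span (F \<union> F\<^sup>\<bottom>)" for x
    proof (rule span_add)
      show "P x \<in> span (F \<union> F\<^sup>\<bottom>)"
        using P(2) span_mono[of F "F \<union> F\<^sup>\<bottom>"] by blast
      show "x - P x \<in> span (F \<union> F\<^sup>\<bottom>)"
        using rest by (intro span_base) blast
    qed
    then show ?thesis
      by auto
  qed
  finally show "closed (range A)" .
  have N: "subspace (nullspace A)"
    by (auto simp: subspace_def nullspace_def A.zero A.add A.scaleR)
  obtain C where C: "C \<subseteq> nullspace A" "independent C" "nullspace A \<subseteq> span C"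
    using maximal_independent_subset by blast
  have span_C: "span C = nullspace A"
    using C(1,3) N by (simp add: span_minimal subset_antisym)
  have "inj_on P (span C)"
    unfolding span_C
  proof (rule inj_onI)
    fix x y
    assume xy: "x \<in> nullspace A" "y \<in> nullspace A" "P x = P y"
    then have "P (x - y) = 0"
      by (simp add: bounded_linear.linear[OF P(1)] linear_diff)
    then have "\<epsilon> * norm (x - y) \<le> norm (A (x - y))"
      using rest[of "x - y"] below by simp
    moreover have "A (x - y) = 0"
      using xy by (simp add: nullspace_def A.diff)
    ultimately show "x = y"
      using \<open>\<epsilon> > 0\<close> by (simp add: mult_le_0_iff)
  qed
  then have "independent (P ` C)" "inj_on P C"
    using linear_independent_injective_image[OF bounded_linear.linear[OF P(1)] C(2)]
      inj_on_subset span_superset by blast+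
  moreover have "P ` C \<subseteq> span F"
    using P(2) by blast
  ultimately have "finite C"
    using independent_span_bound[OF F] finite_imageD by blast
  then show "\<not> infinite_dimensional scaleR (nullspace A)"
    using span_C unfolding infinite_dimensional_scaleR by blast
qed

subsection \<open>Orthonormal sequences almost annihilated by an operator\<close>

text \<open>Contrapositive of \<open>bounded_below_on_finite_codim\<close>, followed by
  normalisation; the strict failure of the bound excludes the zero vector.\<close>

lemma approximate_null_vector:
  fixes A :: "'a::{real_inner, complete_space} \<Rightarrow> 'b::{real_normed_vector, complete_space}"
  assumes A: "bounded_linear A"
    and "\<not> closed (range A) \<or> infinite_dimensional scaleR (nullspace A)"
    and "finite F" "\<epsilon> > 0"
  obtains x where "x \<in> F\<^sup>\<bottom>" "norm x = 1" "norm (A x) \<le> \<epsilon>"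
proof -
  interpret A: bounded_linear A by fact
  obtain x where x: "x \<in> F\<^sup>\<bottom>" "norm (A x) < \<epsilon> * norm x"
    using bounded_below_on_finite_codim[OF A \<open>finite F\<close> \<open>\<epsilon> > 0\<close>] assms(2) by fastforce
  then have "x \<noteq> 0"
    by auto
  show ?thesis
  proof
    show "x /\<^sub>R norm x \<in> F\<^sup>\<bottom>"
      using x(1) by (simp add: subspace_scale subspace_orthogonal_comp)
    show "norm (x /\<^sub>R norm x) = 1"
      using \<open>x \<noteq> 0\<close> by simp
    show "norm (A (x /\<^sub>R norm x)) \<le> \<epsilon>"
      using x(2) \<open>x \<noteq> 0\<close> by (simp add: A.scaleR divide_simps mult.commute)
  qed
qed

lemma approximate_null_sequence:
  fixes A :: "'a::{real_inner, complete_space} \<Rightarrow> 'b::{real_normed_vector, complete_space}"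
  assumes A: "bounded_linear A"
    and "\<not> closed (range A) \<or> infinite_dimensional scaleR (nullspace A)"
  obtains e :: "nat \<Rightarrow> 'a" where "\<And>i j. e i \<bullet> e j = (if i = j then 1 else 0)"
    "\<And>n. norm (A (e n)) \<le> (1 / 2) ^ n"
proof -
  define Q where "Q f n x \<longleftrightarrow> x \<in> (f ` {..<n})\<^sup>\<bottom> \<and> norm x = 1 \<and> norm (A x) \<le> (1 / 2) ^ n"
    for f :: "nat \<Rightarrow> 'a" and n x
  have "\<exists>e. \<forall>n. Q e n (e n)"
  \<comment> \<open>\<open>Q f n\<close> sees \<open>f\<close> only below \<open>n\<close>, so each
    vector is chosen orthogonal to finitely many earlier ones.\<close>
  proof (rule dependent_wellorder_choice)
    fix x :: 'a and f g :: "nat \<Rightarrow> 'a" and n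
    assume "\<And>m. m < n \<Longrightarrow> f m = g m"
    then have "f ` {..<n} = g ` {..<n}"
      by (intro image_cong) auto
    then show "Q f n x = Q g n x"
      by (simp add: Q_def)
  next
    fix n and f :: "nat \<Rightarrow> 'a"
    show "\<exists>x. Q f n x"
      using approximate_null_vector[OF assms, of "f ` {..<n}" "(1 / 2) ^ n"]
      unfolding Q_def by auto
  qed
  then obtain e where e: "\<And>n. Q e n (e n)"
    by blast
  have ortho: "e i \<bullet> e j = 0" if "i < j" for i j
    using e[of j] that by (auto simp: Q_def orthogonal_comp_def orthogonal_def)
  have "e i \<bullet> e j = (if i = j then 1 else 0)" for i j
  proof (cases i j rule: linorder_cases)
    case equal
    then show ?thesis
      using e[of i] by (simp add: Q_def dot_square_norm)
  qed (use ortho[of i j] ortho[of j i] in \<open>auto simp: inner_commute\<close>)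
  moreover have "norm (A (e n)) \<le> (1 / 2) ^ n" for n
    using e[of n] by (simp add: Q_def)
  ultimately show ?thesis
    using that by blast
qed

text \<open>Collects what both scalar fields draw on; nonnegativity of
  \<open>x \<bullet> P x\<close> is there for the complex case.\<close>

lemma projection_with_compact_composition:
  fixes A :: "'a::{real_inner, complete_space} \<Rightarrow> 'b::{real_normed_vector, complete_space}"
  assumes A: "bounded_linear A"
    and "\<not> closed (range A) \<or> infinite_dimensional scaleR (nullspace A)"
  obtains P and e :: "nat \<Rightarrow> 'a" where "bounded_linear P" "compact_operator (\<lambda>x. A (P x))"
    "\<And>x. x \<bullet> P x \<ge> 0" "\<And>i j. e i \<bullet> e j = (if i = j then 1 else 0)" "\<And>n. e n \<bullet> P (e n) = 1"
proof -
  obtain e where e: "\<And>i j. e i \<bullet> e j = (if i = j then 1 else 0)"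
    "\<And>n. norm (A (e n)) \<le> (1 / 2) ^ n"
    using approximate_null_sequence[OF assms] by metis
  obtain P where P: "bounded_linear P" "\<And>x. (\<lambda>n. \<Sum>k<n. (e k \<bullet> x) *\<^sub>R e k) \<longlonglongrightarrow> P x"
    using orthonormal_projection[OF e(1)] by metis
  \<comment> \<open>The quadratic form of \<open>P\<close> is a limit of sums of squares, from which
    both its sign and its value 1 at each \<open>e n\<close> are read off.\<close>
  have lim: "(\<lambda>n. \<Sum>k<n. (e k \<bullet> x)\<^sup>2) \<longlonglongrightarrow> x \<bullet> P x" for x
    using tendsto_inner[OF tendsto_const P(2), of x x]
    by (simp add: inner_sum_right power2_eq_square inner_commute)
  show ?thesis
  proof
    show "bounded_linear P"
      by fact
    show "compact_operator (\<lambda>x. A (P x))"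
      using A e P(2) by (intro compact_operator_comp_projection[of A e P])
        (simp_all add: norm_eq_sqrt_inner)
    show "x \<bullet> P x \<ge> 0" for x
      by (rule LIMSEQ_le_const[OF lim]) (simp add: sum_nonneg)
    show "e n \<bullet> P (e n) = 1" for n
    proof (rule LIMSEQ_unique[OF lim tendsto_eventually])
      have "(\<Sum>k<m. (e k \<bullet> e n)\<^sup>2) = 1" if "m > n" for m
        using that by (simp add: e(1) if_distrib[of "\<lambda>x. x\<^sup>2"] cong: if_cong)
      then show "\<forall>\<^sub>F m in sequentially. (\<Sum>k<m. (e k \<bullet> e n)\<^sup>2) = 1"
        unfolding eventually_sequentially by (meson Suc_le_lessD)
    qed
  qed (rule e(1))
qed

section \<open>Compactness of \<open>B\<close> from compactness of
  \<open>A \<circ> B\<close>\<close>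

lemma compact_operator_of_comp:
  fixes A :: "'a::{real_inner, complete_space} \<Rightarrow> 'b::{real_normed_vector, complete_space}"
    and B :: "'c::real_normed_vector \<Rightarrow> 'a"
  assumes A: "bounded_linear A" and "closed (range A)"
    and "\<not> infinite_dimensional scaleR (nullspace A)"
    and B: "bounded_linear B" and AB: "compact_operator (\<lambda>x. A (B x))"
  shows "compact_operator B"
proof -
  interpret A: bounded_linear A by fact
  interpret B: bounded_linear B by fact
  obtain F where F: "finite F" "span F = nullspace A"
    using assms(3) unfolding infinite_dimensional_scaleR by blast
  obtain P where P: "bounded_linear P" "compact_operator P" "\<And>x. P x \<in> nullspace A"
    "\<And>x y. y \<in> nullspace A \<Longrightarrow> y \<bullet> (x - P x) = 0"
    using finite_dim_projection[OF F(1)] unfolding F(2) by metis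
  interpret P: bounded_linear P by fact
  obtain K where K: "K \<ge> 0" "\<And>y. y \<in> range A \<Longrightarrow> \<exists>x. A x = y \<and> norm x \<le> K * norm y"
    using closed_range_lift[OF A assms(2)] by metis
  have below: "norm (x - P x) \<le> K * norm (A x)" for x
  proof -
    obtain w where w: "A w = A x" "norm w \<le> K * norm (A x)"
      using K(2)[OF rangeI, of x] by blast
    \<comment> \<open>The lift \<open>w\<close> differs from \<open>x - P x\<close> by the null
      vector \<open>u\<close>, which is orthogonal to \<open>x - P x\<close>. By Pythagoras
      \<open>x - P x\<close> is no longer than \<open>w\<close> and inherits its bound.\<close>
    define u where "u = w - x + P x"
    have "u \<in> nullspace A"
      using P(3)[of x] w(1) by (simp add: u_def nullspace_def A.add A.diff)
    then have "orthogonal (x - P x) u"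
      using P(4) by (simp add: orthogonal_def inner_commute)
    moreover have "w = (x - P x) + u"
      by (simp add: u_def)
    ultimately have "(norm w)\<^sup>2 = (norm (x - P x))\<^sup>2 + (norm u)\<^sup>2"
      by (simp add: norm_add_Pythagorean)
    then have "(norm (x - P x))\<^sup>2 \<le> (norm w)\<^sup>2"
      by (metis le_add_same_cancel1 zero_le_power2)
    then have "norm (x - P x) \<le> norm w"
      using norm_ge_zero by (rule power2_le_imp_le)
    then show ?thesis
      using w(2) by linarith
  qed
  have "compact_operator (\<lambda>x. B x - P (B x))"
  proof (rule compact_operator_approx)
    fix r \<epsilon> :: real
    assume "\<epsilon> > 0"
    show "\<exists>T :: 'c \<Rightarrow> 'b. compact_operator T \<and> (\<forall>x\<in>cball 0 r. \<forall>y\<in>cball 0 r.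
        norm (B x - P (B x) - (B y - P (B y))) \<le> norm (T x - T y) + \<epsilon>)"
    proof (intro exI conjI ballI)
      \<comment> \<open>By linearity \<open>below\<close> applies to differences, so this one
        operator dominates for every \<open>r\<close> and \<open>\<epsilon>\<close>.\<close>
      show "compact_operator (\<lambda>x. K *\<^sub>R A (B x))"
        by (rule compact_operator_comp_left[OF bounded_linear_scaleR_right AB])
      fix x y
      have "norm (B x - P (B x) - (B y - P (B y))) = norm (B (x - y) - P (B (x - y)))"
        by (simp add: B.diff P.diff algebra_simps)
      also have "\<dots> \<le> K * norm (A (B (x - y)))"
        by (rule below)
      also have "\<dots> = norm (K *\<^sub>R A (B x) - K *\<^sub>R A (B y))"
        using K(1) by (simp add: B.diff A.diff flip: scaleR_diff_right)
      finally show "norm (B x - P (B x) - (B y - P (B y))) \<le>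
          norm (K *\<^sub>R A (B x) - K *\<^sub>R A (B y)) + \<epsilon>"
        using \<open>\<epsilon> > 0\<close> by linarith
    qed
  qed
  then have "compact_operator (\<lambda>x. (B x - P (B x)) + P (B x))"
    using compact_operator_comp_right[OF P(2) B] by (rule compact_operator_add)
  then show ?thesis
    by simp
qed

subsection \<open>Complex scalars\<close>

text \<open>Reduces complex homogeneity and closure under complex scalars to real scalars together
  with multiplication by \<open>\<i>\<close>.\<close>

lemma scaleC_conv_scaleR: "scaleC c x = Re c *\<^sub>R x + Im c *\<^sub>R scaleC \<i> x"
proof -
  have "scaleC c x = scaleC (of_real (Re c) + of_real (Im c) * \<i>) x"
    by (metis complex_eq mult.commute)
  then show ?thesis
    by (simp only: scaleC_add_left scaleC_of_real flip: scaleC_scaleC)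
qed

lemma scaleC_i_i: "scaleC \<i> (scaleC \<i> x) = - x"
  using scaleC_of_real[of "-1" x] by (simp add: scaleC_scaleC)

text \<open>Multiplication by \<open>\<i>\<close> is skew-adjoint for the real inner product; this
  is what makes \<open>- iPi\<close> positive when \<open>P\<close> is.\<close>

lemma inner_scaleC_i: "inner (scaleC \<i> x) y = - inner x (scaleC \<i> y)"
proof -
  have "cinner (scaleC \<i> x) y = - \<i> * cinner x y"
    by (metis cinner_commute cinner_scaleC_right complex_cnj_i complex_cnj_mult)
  then show ?thesis
    by (simp add: cinner_scaleC_right flip: Re_cinner)
qed

lemma bounded_linear_scaleC_i: "bounded_linear (scaleC \<i> :: 'a::complex_inner \<Rightarrow> 'a)"
proof (rule bounded_linear_intro[where K = 1])
  fix x y :: 'a and r :: real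
  show "scaleC \<i> (x + y) = scaleC \<i> x + scaleC \<i> y"
    by (rule scaleC_add_right)
  show "scaleC \<i> (r *\<^sub>R x) = r *\<^sub>R scaleC \<i> x"
    by (simp add: scaleC_scaleC mult.commute flip: scaleC_of_real)
  show "norm (scaleC \<i> x) \<le> norm x * 1"
    by (simp add: norm_eq_sqrt_inner inner_scaleC_i scaleC_i_i)
qed

text \<open>A finite real spanning set also spans over the complex numbers, and a complex spanning
  set together with its multiples by \<open>\<i>\<close> spans over the reals. The real results
  thereby apply to complex operators.\<close>

lemma infinite_dimensional_nullspace_scaleC:
  assumes "bounded_clinear A"
  shows "infinite_dimensional scaleC (nullspace A) \<longleftrightarrow> infinite_dimensional scaleR (nullspace A)"
proof -
  interpret C: vector_space scaleC
    by (rule vector_space_scaleC)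
  interpret A: bounded_linear A
    using assms by (simp add: bounded_clinear_def)
  have A_scaleC: "A (scaleC c x) = scaleC c (A x)" for c x
    using assms by (simp add: bounded_clinear_def)
  let ?N = "nullspace A"
  have CN: "C.subspace ?N"
    by (auto simp: C.subspace_def nullspace_def A.zero A.add A_scaleC)
  have RN: "subspace ?N"
    by (auto simp: subspace_def nullspace_def A.zero A.add A.scaleR)
  have to_C: "C.span F = ?N" if "span F = ?N" for F
  proof
    have "F \<subseteq> ?N"
      using span_superset[of F] that by simp
    then show "C.span F \<subseteq> ?N"
      using CN by (rule C.span_minimal)
    have "subspace (C.span F)"
      by (simp add: subspace_def C.span_zero C.span_add C.span_scale flip: scaleC_of_real)
    then show "?N \<subseteq> C.span F"
      using span_minimal[OF C.span_superset[of F]] that by simp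
  qed
  have to_R: "span (F \<union> scaleC \<i> ` F) = ?N" if "C.span F = ?N" for F
  proof
    let ?V = "span (F \<union> scaleC \<i> ` F)"
    have "F \<union> scaleC \<i> ` F \<subseteq> C.span F"
      by (auto intro: C.span_base C.span_scale)
    then have "F \<union> scaleC \<i> ` F \<subseteq> ?N"
      unfolding that .
    then show "?V \<subseteq> ?N"
      using RN by (rule span_minimal)
    \<comment> \<open>Multiplication by \<open>\<i>\<close> permutes the generators up to sign, so
      \<open>?V\<close> is invariant under it and hence a complex subspace.\<close>
    have "scaleC \<i> ` ?V = span (scaleC \<i> ` (F \<union> scaleC \<i> ` F))"
      using linear_span_image[OF bounded_linear.linear[OF bounded_linear_scaleC_i]] by metis
    also have "\<dots> \<subseteq> ?V"
      by (rule span_minimal) (auto simp: scaleC_i_i span_base span_neg)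
    finally have i: "scaleC \<i> x \<in> ?V" if "x \<in> ?V" for x
      using that by blast
    have "scaleC c x \<in> ?V" if "x \<in> ?V" for c x
      unfolding scaleC_conv_scaleR[of c] using that i by (intro span_add span_scale)
    then have "C.subspace ?V"
      by (simp add: C.subspace_def span_zero span_add)
    then show "?N \<subseteq> ?V"
      using C.span_minimal[of F ?V] that span_superset[of "F \<union> scaleC \<i> ` F"] by simp
  qed
  have "(\<exists>F. finite F \<and> C.span F = ?N) \<longleftrightarrow> (\<exists>F. finite F \<and> span F = ?N)"
  proof (intro iffI; elim exE conjE)
    fix F
    assume "finite F" "C.span F = ?N"
    then show "\<exists>F. finite F \<and> span F = ?N"
      by (intro exI[of _ "F \<union> scaleC \<i> ` F"] conjI to_R) simp_all
  next
    fix F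
    assume "finite F" "span F = ?N"
    then show "\<exists>F. finite F \<and> C.span F = ?N"
      by (intro exI[of _ F] conjI to_C)
  qed
  then show ?thesis
    unfolding infinite_dimensional_scaleR unfolding infinite_dimensional_def by simp
qed

text \<open>The complex conjunct demands a complex-linear \<open>B\<close>, so its forward direction
  needs more than the real conjunct read over restricted scalars.\<close>

theorem theorem5:
  fixes A :: "'a::{real_inner, complete_space} \<Rightarrow> 'b::{real_inner, complete_space}"
    and A' :: "'c::{complex_inner, complete_space} \<Rightarrow> 'd::{complex_inner, complete_space}"
  shows "(bounded_linear A \<longrightarrow>
           ((\<not> closed (range A) \<or> infinite_dimensional scaleR (nullspace A)) \<longleftrightarrow>
            (\<exists>B :: 'a \<Rightarrow> 'a. bounded_linear B \<and> \<not> compact_operator B \<and> compact_operator (A \<circ> B))))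
       \<and> (bounded_clinear A' \<longrightarrow>
           ((\<not> closed (range A') \<or> infinite_dimensional scaleC (nullspace A')) \<longleftrightarrow>
            (\<exists>B :: 'c \<Rightarrow> 'c. bounded_clinear B \<and> \<not> compact_operator B \<and> compact_operator (A' \<circ> B))))"
proof (intro conjI impI iffI)
  assume A: "bounded_linear A"
  {
    assume "\<not> closed (range A) \<or> infinite_dimensional scaleR (nullspace A)"
    then obtain P and e :: "nat \<Rightarrow> 'a" where P: "bounded_linear P"
      "compact_operator (\<lambda>x. A (P x))" and e: "\<And>i j. e i \<bullet> e j = (if i = j then 1 else 0)"
      "\<And>n. e n \<bullet> P (e n) = 1"
      using projection_with_compact_composition[OF A] by metis
    then have "\<not> compact_operator P"
      using not_compact_operator_orthonormal[of e P] by simp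
    then show "\<exists>B :: 'a \<Rightarrow> 'a. bounded_linear B \<and> \<not> compact_operator B \<and> compact_operator (A \<circ> B)"
      using P by (auto simp: o_def)
  }
  assume "\<exists>B :: 'a \<Rightarrow> 'a. bounded_linear B \<and> \<not> compact_operator B \<and> compact_operator (A \<circ> B)"
  then show "\<not> closed (range A) \<or> infinite_dimensional scaleR (nullspace A)"
    using compact_operator_of_comp[OF A] by (auto simp: o_def)
next
  assume A': "bounded_clinear A'"
  then have lin: "bounded_linear A'" and A'_scaleC: "\<And>c x. A' (scaleC c x) = scaleC c (A' x)"
    by (simp_all add: bounded_clinear_def)
  {
    assume "\<not> closed (range A') \<or> infinite_dimensional scaleC (nullspace A')"
    then obtain P and e :: "nat \<Rightarrow> 'c" where P: "bounded_linear P"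
      "compact_operator (\<lambda>x. A' (P x))" "\<And>x. x \<bullet> P x \<ge> 0"
      and e: "\<And>i j. e i \<bullet> e j = (if i = j then 1 else 0)" "\<And>n. e n \<bullet> P (e n) = 1"
      using projection_with_compact_composition[OF lin]
      unfolding infinite_dimensional_nullspace_scaleC[OF A'] by metis
    \<comment> \<open>This is twice the complex-linear part of \<open>P\<close>, so it commutes with
      \<open>\<i>\<close>.\<close>
    define B where "B x = P x - scaleC \<i> (P (scaleC \<i> x))" for x
    interpret P: bounded_linear P by fact
    note J = bounded_linear_scaleC_i
    interpret J: bounded_linear "scaleC \<i> :: 'c \<Rightarrow> 'c" by (rule J)
    have B: "bounded_linear B"
      unfolding B_def
      by (intro bounded_linear_sub P(1) bounded_linear_compose[OF J]
          bounded_linear_compose[OF P(1) J])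
    interpret B: bounded_linear B by (rule B)
    have "B (scaleC \<i> x) = scaleC \<i> (B x)" for x
      by (simp add: B_def J.diff scaleC_i_i linear_neg[OF P.linear] linear_neg[OF J.linear])
    then have "B (scaleC c x) = scaleC c (B x)" for c x
      unfolding scaleC_conv_scaleR[of c] by (simp add: B.add B.scaleR)
    then have "bounded_clinear B"
      using B by (simp add: bounded_clinear_def)
    moreover have "\<not> compact_operator B"
    proof (rule not_compact_operator_orthonormal[OF e(1)])
      fix n
      \<comment> \<open>Skew-adjointness turns the second term into the quadratic form of
        \<open>P\<close> at \<open>scaleC \<i> (e n)\<close>, which is nonnegative.\<close>
      have "e n \<bullet> B (e n) = 1 + scaleC \<i> (e n) \<bullet> P (scaleC \<i> (e n))"
        by (simp add: B_def inner_diff_right e(2) inner_scaleC_i)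
      then show "e n \<bullet> B (e n) \<ge> 1"
        using P(3) by simp
    qed
    moreover have "compact_operator (A' \<circ> B)"
    proof -
      \<comment> \<open>As \<open>A'\<close> commutes with \<open>\<i>\<close>, the composition
        splits into two terms, each built from the compact \<open>A' \<circ> P\<close> and
        multiplication by \<open>\<i>\<close>.\<close>
      have "compact_operator (\<lambda>x. A' (P x) + - scaleC \<i> (A' (P (scaleC \<i> x))))"
        by (rule compact_operator_add[OF P(2) compact_operator_comp_left[OF
              bounded_linear_minus[OF bounded_linear_scaleC_i]
              compact_operator_comp_right[OF P(2) J]]])
      also have "(\<lambda>x. A' (P x) + - scaleC \<i> (A' (P (scaleC \<i> x)))) = A' \<circ> B"
        by (simp add: fun_eq_iff B_def bounded_linear.linear[OF lin] linear_diff A'_scaleC)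
      finally show ?thesis .
    qed
    ultimately show "\<exists>B :: 'c \<Rightarrow> 'c. bounded_clinear B \<and> \<not> compact_operator B \<and>
        compact_operator (A' \<circ> B)"
      by blast
  }
  assume "\<exists>B :: 'c \<Rightarrow> 'c. bounded_clinear B \<and> \<not> compact_operator B \<and> compact_operator (A' \<circ> B)"
  \<comment> \<open>A complex-linear \<open>B\<close> is in particular real linear, so the real
    converse applies.\<close>
  then show "\<not> closed (range A') \<or> infinite_dimensional scaleC (nullspace A')"
    using compact_operator_of_comp[OF lin]
    unfolding infinite_dimensional_nullspace_scaleC[OF A']
    by (auto simp: o_def bounded_clinear_def)
qed

end
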